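(* Let $\xi\in c_o^*\setminus\ell^1$. (i) If $\eta\in c_o^*$ and $\eta_a\geq\xi_a$, then for every $\varepsilon>0$, $\eta_n\geq(1-\varepsilon)\,\widehat\xi_n$ for all $n$ sufficiently large. (ii) For every $\rho\in c_o^*\setminus\Sigma((\widehat\xi))$, there is an $\eta\in c_o^*$ for which $\eta_a\geq\xi_a$ and $\rho\notin\Sigma((\eta))$.
   Context: $c_o^*$ is the set of nonnegative monotone nonincreasing sequences converging to $0$. For $\xi\in c_o^*$, $(\xi_a)_n:=\frac1n\sum_{j=1}^n\xi_j$, and $\eta_a\ge\xi_a$ means $(\eta_a)_n\ge(\xi_a)_n$ for all $n$. For $\xi\in c_o^*\setminus\ell^1$ define $\nu(\xi)_n:=\min\{k\in\mathbb N\mid\sum_{i=1}^k\xi_i\geq n\xi_1\}$ and $\widehat\xi:=\langle(\xi_a)_{\nu(\xi)_n}\rangle_{n\ge1}$, i.e., $\widehat\xi_n=(\xi_a)_{\nu(\xi)_n}$; one has $\widehat\xi\in c_o^*$. $(\eta)$ denotes the principal ideal of $B(H)$ ($H$ a separable infinite-dimensional complex Hilbert space) generated by the diagonal operator $\mathrm{diag}\,\eta$, and $\Sigma((\eta))$ is the set of s-number (singular value) sequences of its elements; explicitly, $\Sigma((\eta))=\{\rho\in c_o^*\mid\rho=O(D_m\eta)\text{ for some }m\in\mathbb N\}$, where $(D_m\eta)_n:=\eta_{\lceil n/m\rceil}$. *)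

theory Defs
  imports "HOL-Analysis.Analysis" "HOL-Algebra.Ideal"
begin

section \<open>Sequences\<close>

text \<open>Sequences \<open>\<xi>\<^sub>1, \<xi>\<^sub>2, \<dots>\<close> are functions on \<^typ>\<open>nat\<close> shifted by one: \<open>\<xi> n\<close> is the
  term \<open>\<xi>\<^sub>n\<^sub>+\<^sub>1\<close>.\<close>

definition c0star :: "(nat \<Rightarrow> real) set" where
  "c0star = {\<xi>. (\<forall>n. 0 \<le> \<xi> n) \<and> decseq \<xi> \<and> \<xi> \<longlonglongrightarrow> 0}"

definition arith_mean :: "(nat \<Rightarrow> real) \<Rightarrow> nat \<Rightarrow> real" where
  "arith_mean \<xi> n = (\<Sum>j\<le>n. \<xi> j) / real (Suc n)"

text \<open>The argument and the value of \<open>nu \<xi>\<close> are counted from 1, as in the usual notation;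
  hence the shifts in \<open>hat\<close>.\<close>

definition nu :: "(nat \<Rightarrow> real) \<Rightarrow> nat \<Rightarrow> nat" where
  "nu \<xi> n = (LEAST k. 1 \<le> k \<and> (\<Sum>i<k. \<xi> i) \<ge> real n * \<xi> 0)"

definition hat :: "(nat \<Rightarrow> real) \<Rightarrow> nat \<Rightarrow> real" where
  "hat \<xi> n = arith_mean \<xi> (nu \<xi> (Suc n) - 1)"


section \<open>Operators on a complex Hilbert space\<close>

text \<open>The inner product is linear in the first argument. Positive definiteness follows from
  the axiom relating it to the norm.\<close>

class complex_hilbert = banach +
  fixes scaleC :: "complex \<Rightarrow> 'a \<Rightarrow> 'a"
    and cinner :: "'a \<Rightarrow> 'a \<Rightarrow> complex"
  assumes scaleC_add_right: "scaleC a (x + y) = scaleC a x + scaleC a y"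
    and scaleC_add_left: "scaleC (a + b) x = scaleC a x + scaleC b x"
    and scaleC_scaleC: "scaleC a (scaleC b x) = scaleC (a * b) x"
    and scaleC_of_real: "scaleC (complex_of_real r) x = scaleR r x"
    and cinner_commute: "cinner x y = cnj (cinner y x)"
    and cinner_add_left: "cinner (x + y) z = cinner x z + cinner y z"
    and cinner_scaleC_left: "cinner (scaleC a x) y = a * cinner x y"
    and cinner_self: "cinner x x = complex_of_real ((norm x)\<^sup>2)"

definition bounded_clinear :: "('h::complex_hilbert \<Rightarrow> 'h) \<Rightarrow> bool" where
  "bounded_clinear T \<longleftrightarrow> bounded_linear T \<and> (\<forall>a x. T (scaleC a x) = scaleC a (T x))"

definition BH :: "('h::complex_hilbert \<Rightarrow> 'h) ring" where
  "BH = \<lparr>carrier = {T. bounded_clinear T}, mult = (\<circ>), one = id,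
         zero = (\<lambda>x. 0), add = (\<lambda>S T x. S x + T x)\<rparr>"

definition orthonormal_seq :: "(nat \<Rightarrow> 'h::complex_hilbert) \<Rightarrow> bool" where
  "orthonormal_seq e \<longleftrightarrow> (\<forall>m n. cinner (e m) (e n) = (if m = n then 1 else 0))"

text \<open>A complex Hilbert space is separable and infinite-dimensional iff it has an orthonormal
  basis indexed by the natural numbers.\<close>

definition orthonormal_basis :: "(nat \<Rightarrow> 'h::complex_hilbert) \<Rightarrow> bool" where
  "orthonormal_basis e \<longleftrightarrow> orthonormal_seq e \<and> (\<forall>x. (\<forall>n. cinner x (e n) = 0) \<longrightarrow> x = 0)"

definition diag_op :: "(nat \<Rightarrow> 'h::complex_hilbert) \<Rightarrow> (nat \<Rightarrow> real) \<Rightarrow> 'h \<Rightarrow> 'h" where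
  "diag_op e \<eta> x = (\<Sum>n. scaleC (complex_of_real (\<eta> n) * cinner x (e n)) (e n))"

definition adjoint_of :: "('h::complex_hilbert \<Rightarrow> 'h) \<Rightarrow> ('h \<Rightarrow> 'h) \<Rightarrow> bool" where
  "adjoint_of T S \<longleftrightarrow> bounded_clinear S \<and> (\<forall>x y. cinner (T x) y = cinner x (S y))"

definition positive_op :: "('h::complex_hilbert \<Rightarrow> 'h) \<Rightarrow> bool" where
  "positive_op P \<longleftrightarrow> bounded_clinear P \<and> (\<forall>x. cinner (P x) x \<in> \<real>\<^sub>\<ge>\<^sub>0)"

text \<open>\<open>P = (T\<^sup>*T)\<^sup>1\<^sup>/\<^sup>2\<close>\<close>

definition modulus_of :: "('h::complex_hilbert \<Rightarrow> 'h) \<Rightarrow> ('h \<Rightarrow> 'h) \<Rightarrow> bool" where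
  "modulus_of T P \<longleftrightarrow> positive_op P \<and> (\<exists>S. adjoint_of T S \<and> P \<circ> P = S \<circ> T)"

text \<open>\<open>\<rho>\<close> is the s-number sequence of a compact operator \<open>T\<close>: the eigenvalues of \<open>|T|\<close> in
  nonincreasing order and repeated according to multiplicity, completed by zeros if \<open>T\<close> has
  finite rank. The eigenvalue 0 is not listed if \<open>T\<close> has infinite rank, so the eigenvectors
  \<open>f\<close> need not form a basis, but \<open>|T|\<close> vanishes on their orthogonal complement. For finite
  rank the trailing \<open>f n\<close> lie in the kernel.\<close>

definition s_numbers :: "('h::complex_hilbert \<Rightarrow> 'h) \<Rightarrow> (nat \<Rightarrow> real) \<Rightarrow> bool" where
  "s_numbers T \<rho> \<longleftrightarrow> \<rho> \<in> c0star \<and>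
     (\<exists>P f. modulus_of T P \<and> orthonormal_seq f \<and>
        (\<forall>n. P (f n) = scaleC (complex_of_real (\<rho> n)) (f n)) \<and>
        (\<forall>x. (\<forall>n. cinner x (f n) = 0) \<longrightarrow> P x = 0))"

definition char_set :: "('h::complex_hilbert \<Rightarrow> 'h) set \<Rightarrow> (nat \<Rightarrow> real) set" where
  "char_set I = {\<rho>. \<exists>T\<in>I. s_numbers T \<rho>}"

definition principal_ideal :: "(nat \<Rightarrow> 'h::complex_hilbert) \<Rightarrow> (nat \<Rightarrow> real) \<Rightarrow> ('h \<Rightarrow> 'h) set" where
  "principal_ideal e \<eta> = genideal BH {diag_op e \<eta>}"


section \<open>Bounded operators form a ring\<close>

lemma scaleC_zero_right: "scaleC a (0::'h::complex_hilbert) = 0"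
  using scaleC_add_right[of a "0::'h" 0] by simp

lemma bounded_clinear_zero: "bounded_clinear (\<lambda>x::'h::complex_hilbert. 0)"
  by (simp add: bounded_clinear_def scaleC_zero_right)

lemma bounded_clinear_id: "bounded_clinear (id :: 'h::complex_hilbert \<Rightarrow> 'h)"
  by (simp add: bounded_clinear_def id_def)

lemma bounded_clinear_add:
  "bounded_clinear S \<Longrightarrow> bounded_clinear T \<Longrightarrow> bounded_clinear (\<lambda>x. S x + T x)"
  by (simp add: bounded_clinear_def bounded_linear_add scaleC_add_right)

lemma bounded_clinear_compose:
  "bounded_clinear S \<Longrightarrow> bounded_clinear T \<Longrightarrow> bounded_clinear (S \<circ> T)"
  by (simp add: bounded_clinear_def o_def bounded_linear_compose)

lemma bounded_clinear_minus:
  assumes "bounded_clinear (T :: 'h::complex_hilbert \<Rightarrow> 'h)"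
  shows "bounded_clinear (\<lambda>x. - T x)"
proof -
  have "scaleC a (- x) = - scaleC a x" for a and x :: 'h
    using scaleC_add_right[of a "- x" x] by (simp add: scaleC_zero_right eq_neg_iff_add_eq_0)
  with assms show ?thesis
    by (simp add: bounded_clinear_def bounded_linear_minus)
qed

lemma ring_BH: "ring (BH :: ('h::complex_hilbert \<Rightarrow> 'h) ring)"
proof (rule ringI)
  show "abelian_group (BH :: ('h \<Rightarrow> 'h) ring)"
  proof (rule abelian_groupI)
    fix T :: "'h \<Rightarrow> 'h" assume "T \<in> carrier BH"
    then show "\<exists>S\<in>carrier BH. S \<oplus>\<^bsub>BH\<^esub> T = \<zero>\<^bsub>BH\<^esub>"
      by (intro bexI[of _ "\<lambda>x. - T x"]) (auto simp: BH_def bounded_clinear_minus)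
  qed (auto simp: BH_def bounded_clinear_zero bounded_clinear_add add_ac)
  show "Group.monoid (BH :: ('h \<Rightarrow> 'h) ring)"
    by (rule monoidI) (auto simp: BH_def bounded_clinear_id bounded_clinear_compose o_assoc)
qed (auto simp: BH_def bounded_clinear_def o_def linear_add bounded_linear.linear)

end

theory Submission
  imports Defs
begin

text \<open>Part (i): with \<open>k = \<nu>(\<xi>)\<^sub>n\<close>, the sum of the first \<open>k\<close> terms of \<open>\<xi>\<close> is
  \<open>k \<cdot> hat \<xi> n \<ge> n \<xi>\<^sub>1\<close> and is at most \<open>\<eta>\<^sub>1 + \<dots> + \<eta>\<^sub>n + k \<eta>\<^sub>n = o(n) + k \<eta>\<^sub>n\<close>.

  Part (ii): a step function \<open>\<eta>\<close> with values \<open>a\<^sub>j = hat \<xi> q\<^sub>j\<close> on \<open>[p\<^sub>j, p\<^sub>j\<^sub>+\<^sub>1)\<close> satisfies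
  \<open>\<eta>\<^sub>a \<ge> \<xi>\<^sub>a\<close> as soon as \<open>p\<^sub>j\<^sub>+\<^sub>1 a\<^sub>j \<ge> q\<^sub>j\<^sub>+\<^sub>1 \<xi>\<^sub>1\<close>: the left-hand side dominates the partial sums of
  \<open>\<xi>\<close> before \<open>\<nu>(\<xi>)\<close> of \<open>q\<^sub>j\<^sub>+\<^sub>1\<close>, and from there on the means of \<open>\<xi>\<close> are at most \<open>a\<^sub>j\<^sub>+\<^sub>1\<close>. If \<open>\<rho>\<close> is
  dominated by no \<open>D\<^sub>m (hat \<xi>)\<close>, the steps can be placed where \<open>\<rho>\<close> is much larger than
  every \<open>D\<^sub>m \<eta>\<close>.

  The passage between ideals and sequences uses weighted partial isometries in one direction.
  In the other, the operators whose Gelfand numbers are \<open>O(D\<^sub>m \<eta>)\<close> for some \<open>m\<close> form an ideal.\<close>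

section \<open>Orthonormal sequences\<close>

lemma cinner_add_right: "cinner x (y + z) = cinner x y + cinner x (z :: 'h::complex_hilbert)"
  by (metis cinner_add_left cinner_commute complex_cnj_add)

lemma cinner_scaleC_right: "cinner x (scaleC a y) = cnj a * cinner x (y :: 'h::complex_hilbert)"
  by (metis cinner_commute cinner_scaleC_left complex_cnj_mult)

lemma cinner_zero_left [simp]: "cinner 0 (y :: 'h::complex_hilbert) = 0"
  using cinner_add_left[of 0 0 y] by simp

lemma cinner_zero_right [simp]: "cinner (y :: 'h::complex_hilbert) 0 = 0"
  using cinner_add_right[of y 0 0] by simp

lemma cinner_minus_left: "cinner (- x) y = - cinner x (y :: 'h::complex_hilbert)"
  using cinner_add_left[of x "- x" y] by (simp add: eq_neg_iff_add_eq_0 add.commute)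

lemma cinner_minus_right: "cinner x (- y) = - cinner x (y :: 'h::complex_hilbert)"
  using cinner_add_right[of x y "- y"] by (simp add: eq_neg_iff_add_eq_0 add.commute)

lemma cinner_diff_left: "cinner (x - y) z = cinner x z - cinner y (z :: 'h::complex_hilbert)"
  using cinner_add_left[of x "- y" z] by (simp add: cinner_minus_left)

lemma cinner_diff_right: "cinner x (y - z) = cinner x y - cinner x (z :: 'h::complex_hilbert)"
  using cinner_add_right[of x y "- z"] by (simp add: cinner_minus_right)

lemma cinner_sum_left: "cinner (\<Sum>n\<in>F. u n) y = (\<Sum>n\<in>F. cinner (u n) (y :: 'h::complex_hilbert))"
  by (induction F rule: infinite_finite_induct) (auto simp: cinner_add_left)

lemma cinner_sum_right: "cinner y (\<Sum>n\<in>F. u n) = (\<Sum>n\<in>F. cinner (y :: 'h::complex_hilbert) (u n))"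
  by (induction F rule: infinite_finite_induct) (auto simp: cinner_add_right)

lemma norm_scaleC: "norm (scaleC a (x :: 'h::complex_hilbert)) = cmod a * norm x"
proof -
  have "complex_of_real ((norm (scaleC a x))\<^sup>2) = a * cnj a * complex_of_real ((norm x)\<^sup>2)"
    by (simp only: cinner_self[symmetric] cinner_scaleC_left cinner_scaleC_right mult_ac)
  also have "\<dots> = complex_of_real ((cmod a * norm x)\<^sup>2)"
    by (simp only: complex_norm_square of_real_mult power_mult_distrib)
  finally show ?thesis
    using of_real_eq_iff by (metis norm_ge_zero mult_nonneg_nonneg power2_eq_iff_nonneg)
qed

lemma bounded_linear_scaleC: "bounded_linear (scaleC a :: 'h::complex_hilbert \<Rightarrow> 'h)"
proof (rule bounded_linear_intro)
  show "scaleC a (r *\<^sub>R x) = r *\<^sub>R scaleC a (x :: 'h)" for r x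
    by (simp only: scaleC_of_real[symmetric] scaleC_scaleC mult.commute)
  show "norm (scaleC a x) \<le> norm x * cmod a" for x :: 'h
    by (simp add: norm_scaleC)
qed (rule scaleC_add_right)

lemma orthonormal_cinner:
  "orthonormal_seq g \<Longrightarrow> cinner (g m) (g n) = (if m = n then 1 else 0)"
  by (simp add: orthonormal_seq_def)

lemma cinner_orthonormal_sum:
  fixes g :: "nat \<Rightarrow> 'h::complex_hilbert"
  assumes "orthonormal_seq g" "finite F"
  shows "cinner (\<Sum>n\<in>F. scaleC (a n) (g n)) (\<Sum>n\<in>F. scaleC (b n) (g n)) = (\<Sum>n\<in>F. a n * cnj (b n))"
proof -
  have "cinner (\<Sum>n\<in>F. scaleC (a n) (g n)) (\<Sum>n\<in>F. scaleC (b n) (g n)) =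
      (\<Sum>n\<in>F. \<Sum>m\<in>F. a m * (cnj (b n) * (if m = n then 1 else 0)))"
    by (simp only: cinner_sum_left cinner_sum_right
        cinner_scaleC_left cinner_scaleC_right orthonormal_cinner[OF assms(1)]
        sum_distrib_left mult.left_commute)
  also have "\<dots> = (\<Sum>n\<in>F. a n * cnj (b n))"
  proof (rule sum.cong[OF refl])
    fix n assume n: "n \<in> F"
    have "(\<Sum>m\<in>F. a m * (cnj (b n) * (if m = n then 1 else 0))) =
        (\<Sum>m\<in>F. if m = n then a m * cnj (b n) else 0)"
      by (intro sum.cong) auto
    then show "(\<Sum>m\<in>F. a m * (cnj (b n) * (if m = n then 1 else 0))) = a n * cnj (b n)"
      using n assms(2) by simp
  qed
  finally show ?thesis .
qed

lemma norm_orthonormal_sum: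
  fixes g :: "nat \<Rightarrow> 'h::complex_hilbert"
  assumes "orthonormal_seq g" "finite F"
  shows "(norm (\<Sum>n\<in>F. scaleC (a n) (g n)))\<^sup>2 = (\<Sum>n\<in>F. (cmod (a n))\<^sup>2)"
proof -
  have "complex_of_real ((norm (\<Sum>n\<in>F. scaleC (a n) (g n)))\<^sup>2) =
      complex_of_real (\<Sum>n\<in>F. (cmod (a n))\<^sup>2)"
    by (simp only: cinner_self[symmetric] cinner_orthonormal_sum[OF assms]
        of_real_sum complex_norm_square)
  then show ?thesis
    by (simp only: of_real_eq_iff)
qed

text \<open>\<open>s\<close> is the orthogonal projection of \<open>x\<close> onto the span of the
  chosen \<open>f n\<close>, and \<open>B\<close> is both its squared norm and its inner product
  with \<open>x\<close>. So \<open>B\<close> falls short of the squared norm of \<open>x\<close> by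
  exactly that of \<open>x - s\<close>.\<close>

lemma Bessel_finite:
  fixes f :: "nat \<Rightarrow> 'h::complex_hilbert"
  assumes "orthonormal_seq f" "finite F"
  shows "(\<Sum>n\<in>F. (cmod (cinner x (f n)))\<^sup>2) \<le> (norm x)\<^sup>2"
proof -
  define s where "s = (\<Sum>n\<in>F. scaleC (cinner x (f n)) (f n))"
  define B where "B = (\<Sum>n\<in>F. (cmod (cinner x (f n)))\<^sup>2)"
  have sx: "cinner s x = complex_of_real B"
    unfolding s_def B_def cinner_sum_left of_real_sum cinner_scaleC_left complex_norm_square
    by (intro sum.cong refl) (metis cinner_commute)
  then have xs: "cinner x s = complex_of_real B"
    by (metis cinner_commute complex_cnj_complex_of_real)
  have ss: "cinner s s = complex_of_real B"
    unfolding cinner_self s_def norm_orthonormal_sum[OF assms] B_def ..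
  have "complex_of_real ((norm (x - s))\<^sup>2) = complex_of_real ((norm x)\<^sup>2 - B)"
    by (simp only: cinner_self[symmetric] cinner_diff_left cinner_diff_right sx xs ss)
       (simp add: cinner_self)
  then have "(norm x)\<^sup>2 - B = (norm (x - s))\<^sup>2"
    by (simp only: of_real_eq_iff)
  then show ?thesis
    using zero_le_power2[of "norm (x - s)"] unfolding B_def by linarith
qed

lemma Cauchy_Schwarz_cinner: "cmod (cinner x y) \<le> norm x * norm (y :: 'h::complex_hilbert)"
proof (cases "y = 0")
  case False
  \<comment> \<open>The projection of \<open>x\<close> onto the line through \<open>y\<close>; the
    inequality is again the nonnegativity of the squared norm of the remainder.\<close>
  define u where "u = scaleC (inverse (complex_of_real ((norm y)\<^sup>2)) * cinner x y) y"
  have ny: "complex_of_real ((norm y)\<^sup>2) \<noteq> 0"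
    using False by simp
  have c: "cinner y x = cnj (cinner x y)"
    by (rule cinner_commute)
  have "cinner (x - u) (x - u) = cinner x x - cinner x y * cnj (cinner x y) / complex_of_real ((norm y)\<^sup>2)"
    using ny unfolding u_def
    by (simp add: cinner_diff_left cinner_diff_right cinner_scaleC_left cinner_scaleC_right
        cinner_self[of y] c divide_simps)
  then have "complex_of_real ((norm (x - u))\<^sup>2) =
      complex_of_real ((norm x)\<^sup>2 - (cmod (cinner x y))\<^sup>2 / (norm y)\<^sup>2)"
    by (simp only: cinner_self complex_norm_square[symmetric] of_real_diff of_real_divide of_real_power)
  then have "(norm x)\<^sup>2 - (cmod (cinner x y))\<^sup>2 / (norm y)\<^sup>2 = (norm (x - u))\<^sup>2"
    by (simp only: of_real_eq_iff)
  then have "(cmod (cinner x y))\<^sup>2 / (norm y)\<^sup>2 \<le> (norm x)\<^sup>2"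
    using zero_le_power2[of "norm (x - u)"] by linarith
  then have "(cmod (cinner x y))\<^sup>2 \<le> (norm x * norm y)\<^sup>2"
    using False by (simp add: divide_le_eq power_mult_distrib)
  then show ?thesis
    by (rule power2_le_imp_le) simp
qed simp

lemma bounded_linear_cinner_left: "bounded_linear (\<lambda>x. cinner x (y :: 'h::complex_hilbert))"
proof (rule bounded_linear_intro)
  show "cinner (r *\<^sub>R x) y = r *\<^sub>R cinner x y" for r x
    by (simp only: scaleC_of_real[symmetric] cinner_scaleC_left scaleR_conv_of_real)
qed (rule cinner_add_left, rule Cauchy_Schwarz_cinner)

text \<open>By Pythagoras, blocks of the vector series have the same size as blocks of the scalar
  series, so the Cauchy criterion carries over and completeness does the rest.\<close>

lemma orthonormal_summable:
  fixes g :: "nat \<Rightarrow> 'h::complex_hilbert"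
  assumes g: "orthonormal_seq g" and a: "summable (\<lambda>n. (cmod (a n))\<^sup>2)"
  shows "summable (\<lambda>n. scaleC (a n) (g n))"
  unfolding summable_Cauchy
proof (intro allI impI)
  fix e :: real assume e: "e > 0"
  then obtain N where N: "\<forall>m\<ge>N. \<forall>n. norm (\<Sum>i\<in>{m..<n}. (cmod (a i))\<^sup>2) < e\<^sup>2"
    using a unfolding summable_Cauchy by (metis zero_less_power)
  have "norm (\<Sum>i\<in>{m..<n}. scaleC (a i) (g i)) < e" if "m \<ge> N" for m n
  proof -
    have "(norm (\<Sum>i\<in>{m..<n}. scaleC (a i) (g i)))\<^sup>2 < e\<^sup>2"
      using N that by (simp add: norm_orthonormal_sum[OF g] sum_nonneg)
    then show ?thesis
      using e by (simp add: power_less_imp_less_base)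
  qed
  then show "\<exists>N. \<forall>m\<ge>N. \<forall>n. norm (\<Sum>i\<in>{m..<n}. scaleC (a i) (g i)) < e"
    by blast
qed

section \<open>Weighted partial isometries\<close>

text \<open>For orthonormal \<open>f\<close> and \<open>g\<close> this sends \<open>f n\<close> to
  \<open>c n\<close> times \<open>g n\<close>. Two separate systems allow one construction to serve
  both for diagonal operators and for the transport between a residue class of basis vectors and the
  whole basis.\<close>

definition weighted_op ::
    "(nat \<Rightarrow> complex) \<Rightarrow> (nat \<Rightarrow> 'h::complex_hilbert) \<Rightarrow> (nat \<Rightarrow> 'h) \<Rightarrow> 'h \<Rightarrow> 'h" where
  "weighted_op c f g x = (\<Sum>n. scaleC (c n * cinner x (f n)) (g n))"

lemma diag_op_eq_weighted_op: "diag_op e \<eta> = weighted_op (\<lambda>n. complex_of_real (\<eta> n)) e e"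
  by (simp add: fun_eq_iff diag_op_def weighted_op_def)

text \<open>The weights are bounded only where \<open>x\<close> has a nonzero coefficient, so that
  for a vector orthogonal to the first \<open>n\<close> basis vectors the norm bound for
  \<open>diag_op e \<eta>\<close> improves from \<open>\<eta> 0\<close> to
  \<open>\<eta> n\<close>.\<close>

lemma
  fixes f g :: "nat \<Rightarrow> 'h::complex_hilbert"
  assumes f: "orthonormal_seq f" and g: "orthonormal_seq g" and K: "0 \<le> K"
    and c: "\<And>n. cinner x (f n) \<noteq> 0 \<Longrightarrow> cmod (c n) \<le> K"
  shows weighted_op_sums: "(\<lambda>n. scaleC (c n * cinner x (f n)) (g n)) sums weighted_op c f g x"
    and norm_weighted_op_le: "norm (weighted_op c f g x) \<le> K * norm x"
proof -
  have le: "(cmod (c n * cinner x (f n)))\<^sup>2 \<le> K\<^sup>2 * (cmod (cinner x (f n)))\<^sup>2" for n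
    using c[of n] K
    by (cases "cinner x (f n) = 0") (auto simp: norm_mult power_mult_distrib intro!: mult_right_mono power_mono)
  have part: "(\<Sum>n<N. (cmod (c n * cinner x (f n)))\<^sup>2) \<le> (K * norm x)\<^sup>2" for N
  proof -
    have "(\<Sum>n<N. (cmod (c n * cinner x (f n)))\<^sup>2) \<le> K\<^sup>2 * (\<Sum>n<N. (cmod (cinner x (f n)))\<^sup>2)"
      unfolding sum_distrib_left by (intro sum_mono le)
    also have "\<dots> \<le> K\<^sup>2 * (norm x)\<^sup>2"
      by (intro mult_left_mono Bessel_finite f) auto
    finally show ?thesis
      by (simp add: power_mult_distrib)
  qed
  have "summable (\<lambda>n. (cmod (c n * cinner x (f n)))\<^sup>2)"
    by (rule summableI_nonneg_bounded[OF _ part]) simp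
  then show sums: "(\<lambda>n. scaleC (c n * cinner x (f n)) (g n)) sums weighted_op c f g x"
    unfolding weighted_op_def by (intro summable_sums orthonormal_summable g)
  have "norm (\<Sum>n<N. scaleC (c n * cinner x (f n)) (g n)) \<le> K * norm x" for N
  proof (rule power2_le_imp_le)
    show "(norm (\<Sum>n<N. scaleC (c n * cinner x (f n)) (g n)))\<^sup>2 \<le> (K * norm x)\<^sup>2"
      using part by (simp add: norm_orthonormal_sum[OF g])
  qed (use K in simp)
  then show "norm (weighted_op c f g x) \<le> K * norm x"
    using sums by (intro LIMSEQ_le_const2[OF tendsto_norm]) (auto simp: sums_def)
qed

lemma cinner_weighted_op_sums:
  fixes f g :: "nat \<Rightarrow> 'h::complex_hilbert"
  assumes "orthonormal_seq f" "orthonormal_seq g" and c: "\<And>n. cmod (c n) \<le> K"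
  shows "(\<lambda>n. c n * cinner x (f n) * cinner (g n) y) sums cinner (weighted_op c f g x) y"
proof -
  have "0 \<le> K"
    using c[of 0] norm_ge_zero order_trans by blast
  from bounded_linear.sums[OF bounded_linear_cinner_left[of y] weighted_op_sums[OF assms(1,2) this c]]
  show ?thesis
    by (simp add: cinner_scaleC_left)
qed

lemma cinner_weighted_op:
  fixes f g :: "nat \<Rightarrow> 'h::complex_hilbert"
  assumes "orthonormal_seq f" and g: "orthonormal_seq g" and c: "\<And>n. cmod (c n) \<le> K"
  shows "cinner (weighted_op c f g x) (g m) = c m * cinner x (f m)"
proof -
  have "(\<lambda>n. if n = m then c n * cinner x (f n) else 0) sums cinner (weighted_op c f g x) (g m)"
    using cinner_weighted_op_sums[where x = x and y = "g m", OF assms]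
    by (simp add: orthonormal_cinner[OF g] if_distrib cong: if_cong)
  then show ?thesis
    using sums_single[of m "\<lambda>n. c n * cinner x (f n)"] sums_unique2 by blast
qed

lemma bounded_clinear_weighted_op:
  fixes f g :: "nat \<Rightarrow> 'h::complex_hilbert"
  assumes fg: "orthonormal_seq f" "orthonormal_seq g" and c: "\<And>n. cmod (c n) \<le> K"
  shows "bounded_clinear (weighted_op c f g)"
proof -
  have K: "0 \<le> K"
    using c[of 0] norm_ge_zero order_trans by blast
  have sums: "(\<lambda>n. scaleC (c n * cinner x (f n)) (g n)) sums weighted_op c f g x" for x
    by (rule weighted_op_sums[OF fg K c])
  have hom: "weighted_op c f g (scaleC a x) = scaleC a (weighted_op c f g x)" for a x
  proof -
    have "(\<lambda>n. scaleC (c n * cinner (scaleC a x) (f n)) (g n)) sums scaleC a (weighted_op c f g x)"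
      using bounded_linear.sums[OF bounded_linear_scaleC[of a] sums[of x]]
      by (simp add: cinner_scaleC_left scaleC_scaleC mult_ac)
    then show ?thesis
      using sums sums_unique2 by blast
  qed
  have "bounded_linear (weighted_op c f g)"
  proof (rule bounded_linear_intro)
    fix x y :: 'h
    have "(\<lambda>n. scaleC (c n * cinner (x + y) (f n)) (g n)) sums
        (weighted_op c f g x + weighted_op c f g y)"
      using sums_add[OF sums[of x] sums[of y]]
      by (simp add: cinner_add_left distrib_left scaleC_add_left)
    then show "weighted_op c f g (x + y) = weighted_op c f g x + weighted_op c f g y"
      using sums sums_unique2 by blast
    show "weighted_op c f g (r *\<^sub>R x) = r *\<^sub>R weighted_op c f g x" for r
      using hom[of "complex_of_real r" x] by (simp add: scaleC_of_real)
    show "norm (weighted_op c f g x) \<le> norm x * K"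
      using norm_weighted_op_le[OF fg K c] by (simp add: mult.commute)
  qed
  with hom show ?thesis
    by (simp add: bounded_clinear_def)
qed

section \<open>The characteristic set of a principal ideal\<close>

lemma c0star_abs_le: "\<eta> \<in> c0star \<Longrightarrow> \<bar>\<eta> n\<bar> \<le> \<eta> 0"
  by (simp add: c0star_def decseq_def)

lemma bounded_clinear_diag_op:
  assumes "orthonormal_seq e" "\<eta> \<in> c0star"
  shows "bounded_clinear (diag_op e \<eta>)"
  unfolding diag_op_eq_weighted_op using c0star_abs_le[OF assms(2)]
  by (intro bounded_clinear_weighted_op[where K = "\<eta> 0"] assms) simp

lemma cinner_diag_op:
  assumes "orthonormal_seq e" "\<eta> \<in> c0star"
  shows "cinner (diag_op e \<eta> x) (e n) = complex_of_real (\<eta> n) * cinner x (e n)"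
  unfolding diag_op_eq_weighted_op using c0star_abs_le[OF assms(2)]
  by (intro cinner_weighted_op[where K = "\<eta> 0"] assms) simp

lemma cinner_diag_op_sums:
  assumes "orthonormal_seq e" "\<eta> \<in> c0star"
  shows "(\<lambda>n. complex_of_real (\<eta> n) * cinner x (e n) * cinner (e n) y) sums cinner (diag_op e \<eta> x) y"
  unfolding diag_op_eq_weighted_op using c0star_abs_le[OF assms(2)]
  by (intro cinner_weighted_op_sums[where K = "\<eta> 0"] assms) simp

lemma orthonormal_basis_eqI:
  assumes "orthonormal_basis e" "\<And>n. cinner x (e n) = cinner y (e n)"
  shows "x = y"
proof -
  have "\<forall>n. cinner (x - y) (e n) = 0"
    by (simp add: cinner_diff_left assms(2))
  then have "x - y = 0"
    using assms(1) unfolding orthonormal_basis_def by blast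
  then show ?thesis
    by simp
qed

section \<open>Diagonal operators: their s-numbers and the ideals containing them\<close>

text \<open>With nonnegative entries the operator is self-adjoint and positive, hence its own
  modulus, and \<open>e\<close> itself is the system of eigenvectors.\<close>

lemma s_numbers_diag_op:
  assumes e: "orthonormal_basis e" and \<rho>: "\<rho> \<in> c0star"
  shows "s_numbers (diag_op e \<rho>) \<rho>"
proof -
  have on: "orthonormal_seq e"
    using e by (simp add: orthonormal_basis_def)
  note D = bounded_clinear_diag_op[OF on \<rho>]
  have nonneg: "0 \<le> \<rho> n" for n
    using \<rho> by (simp add: c0star_def)
  have "cinner (diag_op e \<rho> x) y = cinner x (diag_op e \<rho> y)" for x y
  proof -
    have eq: "complex_of_real (\<rho> n) * cinner x (e n) * cinner (e n) y =
        cnj (complex_of_real (\<rho> n) * cinner y (e n) * cinner (e n) x)" for n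
      by (simp add: cinner_commute[of "e n"])
    have "(\<lambda>n. complex_of_real (\<rho> n) * cinner x (e n) * cinner (e n) y) sums
        cnj (cinner (diag_op e \<rho> y) x)"
      unfolding eq by (subst sums_cnj) (rule cinner_diag_op_sums[OF on \<rho>])
    then show ?thesis
      using cinner_diag_op_sums[OF on \<rho>] sums_unique2 by (metis cinner_commute)
  qed
  then have adj: "adjoint_of (diag_op e \<rho>) (diag_op e \<rho>)"
    using D by (simp add: adjoint_of_def)
  \<comment> \<open>The partial sums of the quadratic form are nonnegative reals, and these form a
    closed subset of the complex plane.\<close>
  have "cinner (diag_op e \<rho> x) x \<in> \<real>\<^sub>\<ge>\<^sub>0" for x
  proof -
    have "complex_of_real (\<rho> n) * cinner x (e n) * cinner (e n) x =
        complex_of_real (\<rho> n * (cmod (cinner x (e n)))\<^sup>2)" for n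
      by (subst cinner_commute[of "e n"], subst of_real_mult, subst complex_norm_square)
         (simp add: mult.assoc)
    then have "(\<Sum>n<N. complex_of_real (\<rho> n) * cinner x (e n) * cinner (e n) x) =
        complex_of_real (\<Sum>n<N. \<rho> n * (cmod (cinner x (e n)))\<^sup>2)" for N
      by (simp only: of_real_sum)
    then have "(\<Sum>n<N. complex_of_real (\<rho> n) * cinner x (e n) * cinner (e n) x) \<in> \<real>\<^sub>\<ge>\<^sub>0" for N
      using nonneg by (simp only: nonneg_Reals_of_real_iff sum_nonneg mult_nonneg_nonneg zero_le_power2)
    then show ?thesis
      using cinner_diag_op_sums[OF on \<rho>, of x x] unfolding sums_def
      by (intro Lim_in_closed_set[OF closed_nonneg_Reals_complex]) auto
  qed
  then have "modulus_of (diag_op e \<rho>) (diag_op e \<rho>)"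
    using D adj unfolding modulus_of_def positive_op_def by auto
  moreover have "diag_op e \<rho> (e n) = scaleC (complex_of_real (\<rho> n)) (e n)" for n
    by (rule orthonormal_basis_eqI[OF e])
       (simp add: cinner_diag_op[OF on \<rho>] cinner_scaleC_left orthonormal_cinner[OF on])
  moreover have "diag_op e \<rho> x = 0" if "\<forall>n. cinner x (e n) = 0" for x
    using that by (intro orthonormal_basis_eqI[OF e]) (simp add: cinner_diag_op[OF on \<rho>])
  ultimately show ?thesis
    using on \<rho> unfolding s_numbers_def by blast
qed

lemma ideal_BH_sum:
  assumes "ideal I BH" "\<And>r. r < (m::nat) \<Longrightarrow> U r \<in> I"
  shows "(\<lambda>x. \<Sum>r<m. U r x) \<in> I"
  using assms(2)
proof (induction m)
  case 0
  have "\<zero>\<^bsub>BH\<^esub> \<in> I"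
    using assms(1) by (intro additive_subgroup.zero_closed ideal.axioms)
  then show ?case
    by (simp add: BH_def)
next
  case (Suc m)
  have "(\<lambda>x. \<Sum>r<m. U r x) \<oplus>\<^bsub>BH\<^esub> U m \<in> I"
    using Suc assms(1) by (intro additive_subgroup.a_closed ideal.axioms) auto
  then show ?case
    by (simp add: BH_def)
qed

text \<open>The block \<open>diag (\<rho>\<^sub>r, \<rho>\<^sub>m\<^sub>+\<^sub>r, \<rho>\<^sub>2\<^sub>m\<^sub>+\<^sub>r, \<dots>)\<close> along the residue class of \<open>r\<close> factors
  through \<open>diag \<eta>\<close> by weighted partial isometries; \<open>diag \<rho>\<close> is the sum of these blocks.\<close>

lemma diag_op_in_principal_ideal:
  assumes e: "orthonormal_basis e" and \<rho>: "\<rho> \<in> c0star" and \<eta>: "\<eta> \<in> c0star" and m: "m > 0"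
    and le: "\<And>n. \<rho> n \<le> C * \<eta> (n div m)"
  shows "diag_op e \<rho> \<in> principal_ideal e \<eta>"
  unfolding principal_ideal_def genideal_def
proof (rule InterI)
  fix I assume "I \<in> {I. ideal I BH \<and> {diag_op e \<eta>} \<subseteq> I}"
  then have I: "ideal I BH" and D: "diag_op e \<eta> \<in> I"
    by auto
  have on: "orthonormal_seq e"
    using e by (simp add: orthonormal_basis_def)
  have on': "orthonormal_seq (\<lambda>k. e (k * m + r))" for r
    using m by (simp add: orthonormal_seq_def orthonormal_cinner[OF on])
  \<comment> \<open>Where \<open>\<eta> k = 0\<close> the quotient is 0 by convention; for
    \<open>r < m\<close> this is the right value, since the hypothesis then forces
    \<open>\<rho> (k * m + r) = 0\<close>.\<close>
  define c where "c r k = complex_of_real (\<rho> (k * m + r) / \<eta> k)" for r k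
  \<comment> \<open>\<open>B r\<close> compresses the coordinates of residue class \<open>r\<close>
    to consecutive positions, \<open>diag_op e \<eta>\<close> multiplies them by
    \<open>\<eta> k\<close>, and \<open>A r\<close> spreads them back while correcting
    \<open>\<eta> k\<close> to \<open>\<rho> (k * m + r)\<close>.\<close>
  define A where "A r = weighted_op (c r) e (\<lambda>k. e (k * m + r))" for r
  define B where "B r = weighted_op (\<lambda>_. 1) (\<lambda>k. e (k * m + r)) e" for r
  have pos: "0 \<le> \<rho> n" "0 \<le> \<eta> n" for n
    using \<rho> \<eta> by (auto simp: c0star_def)
  have c: "cmod (c r k) \<le> \<bar>C\<bar>" if "r < m" for r k
  proof -
    have "\<rho> (k * m + r) \<le> \<bar>C\<bar> * \<eta> k"
      using le[of "k * m + r"] that mult_right_mono[OF abs_ge_self[of C] pos(2)[of k]] by simp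
    then show ?thesis
      using pos[of k] pos(1)[of "k * m + r"]
      by (cases "\<eta> k = 0") (simp_all add: c_def norm_divide divide_le_eq)
  qed
  have "A r \<in> carrier BH" if "r < m" for r
    unfolding A_def BH_def
    using bounded_clinear_weighted_op[OF on on', where c = "c r" and K = "\<bar>C\<bar>"] c[OF that] by simp
  moreover have "B r \<in> carrier BH" for r
    unfolding B_def BH_def
    using bounded_clinear_weighted_op[OF on' on, where c = "\<lambda>_. 1" and K = 1] by simp
  ultimately have "A r \<circ> (diag_op e \<eta> \<circ> B r) \<in> I" if "r < m" for r
    using that ideal.I_l_closed[OF I ideal.I_r_closed[OF I D]] by (simp add: BH_def)
  then have sum_mem: "(\<lambda>x. \<Sum>r<m. (A r \<circ> (diag_op e \<eta> \<circ> B r)) x) \<in> I"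
    by (rule ideal_BH_sum[OF I])
  have "(\<lambda>x. \<Sum>r<m. (A r \<circ> (diag_op e \<eta> \<circ> B r)) x) = diag_op e \<rho>"
  proof (rule ext, rule orthonormal_basis_eqI[OF e])
    fix x j
    have "cinner (A r (diag_op e \<eta> (B r x))) (e j) =
        (if r = j mod m then complex_of_real (\<rho> j) * cinner x (e j) else 0)" if r: "r < m" for r
    proof (cases "r = j mod m")
      case True
      then have j: "e j = e (j div m * m + r)"
        by simp
      have "cinner (A r (diag_op e \<eta> (B r x))) (e j) =
          c r (j div m) * (\<eta> (j div m) * cinner x (e j))"
        unfolding A_def j
        by (subst cinner_weighted_op[where K = "\<bar>C\<bar>", OF on on' c[OF r]])
           (simp add: cinner_diag_op[OF on \<eta>] B_def cinner_weighted_op[where K = 1, OF on' on])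
      moreover have "c r (j div m) * \<eta> (j div m) = \<rho> j"
        using le[of j] pos(1)[of j] True by (auto simp: c_def)
      ultimately show ?thesis
        using True by (metis mult.assoc)
    next
      case False
      have "cinner (e (k * m + r)) (e j) = 0" for k
        using False r by (auto simp: orthonormal_cinner[OF on])
      then have "(\<lambda>_. 0) sums cinner (A r (diag_op e \<eta> (B r x))) (e j)"
        using cinner_weighted_op_sums[where K = "\<bar>C\<bar>" and y = "e j" and x = "diag_op e \<eta> (B r x)"
            and c = "c r", OF on on'[of r] c[OF r]]
        by (simp add: A_def)
      from sums_unique2[OF this sums_zero] False show ?thesis
        by simp
    qed
    then have "cinner (\<Sum>r<m. (A r \<circ> (diag_op e \<eta> \<circ> B r)) x) (e j) =
        (\<Sum>r<m. if r = j mod m then complex_of_real (\<rho> j) * cinner x (e j) else 0)"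
      unfolding cinner_sum_left comp_apply by (rule sum.cong[OF refl]) (simp only: lessThan_iff)
    also have "\<dots> = cinner (diag_op e \<rho> x) (e j)"
      unfolding cinner_diag_op[OF on \<rho>] using m by simp
    finally show "cinner (\<Sum>r<m. (A r \<circ> (diag_op e \<eta> \<circ> B r)) x) (e j) = cinner (diag_op e \<rho> x) (e j)" .
  qed
  with sum_mem show "diag_op e \<rho> \<in> I"
    by (simp only:)
qed

section \<open>Gelfand numbers and the ideals they define\<close>

text \<open>Gaussian elimination: a nonzero pivot in equation \<open>j\<close> removes one unknown
  and one equation, and the pivot unknown is recovered at the end. Equations may be indexed by any
  type because they will be linear functionals.\<close>

lemma underdetermined_system:
  fixes A :: "'b \<Rightarrow> 'a \<Rightarrow> 'c::field"
  assumes "finite J" "finite I" "card J < card I"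
  shows "\<exists>c. (\<exists>i\<in>I. c i \<noteq> 0) \<and> (\<forall>j\<in>J. (\<Sum>i\<in>I. c i * A j i) = 0)"
  using assms
proof (induction J arbitrary: I A rule: finite_induct)
  case empty
  then have "I \<noteq> {}"
    by auto
  then show ?case
    by (intro exI[of _ "\<lambda>_. 1"]) auto
next
  case (insert j J)
  show ?case
  proof (cases "\<forall>i\<in>I. A j i = 0")
    case True
    have "card J < card I"
      using insert by simp
    with insert.IH[OF insert.prems(1) this, of A] True show ?thesis
      by auto
  next
    case False
    then obtain p where p: "p \<in> I" "A j p \<noteq> 0"
      by blast
    have "card J < card (I - {p})"
      using insert p by simp
    from insert.IH[OF _ this, of "\<lambda>j' i. A j' i - A j' p * A j i / A j p"] insert.prems(1)
    obtain c where c: "\<exists>i\<in>I-{p}. c i \<noteq> 0"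
      and sum0: "\<forall>j'\<in>J. (\<Sum>i\<in>I-{p}. c i * (A j' i - A j' p * A j i / A j p)) = 0"
      by auto
    define s where "s = (\<Sum>i\<in>I-{p}. c i * A j i)"
    define c' where "c' = c(p := - s / A j p)"
    have split: "(\<Sum>i\<in>I. c' i * A j' i) = - s / A j p * A j' p + (\<Sum>i\<in>I-{p}. c i * A j' i)" for j'
      using insert.prems(1) p by (subst sum.remove[of _ p]) (auto simp: c'_def intro!: sum.cong)
    have "(\<Sum>i\<in>I. c' i * A j' i) = 0" if "j' \<in> J" for j'
    proof -
      have "0 = (\<Sum>i\<in>I-{p}. c i * A j' i - A j' p / A j p * (c i * A j i))"
        using sum0 that by (simp add: right_diff_distrib mult_ac)
      also have "\<dots> = (\<Sum>i\<in>I-{p}. c i * A j' i) - A j' p / A j p * s"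
        by (simp add: sum_subtractf sum_distrib_left s_def)
      finally show ?thesis
        by (simp add: split mult_ac)
    qed
    moreover have "(\<Sum>i\<in>I. c' i * A j i) = 0"
      using p by (simp add: split s_def)
    moreover have "\<exists>i\<in>I. c' i \<noteq> 0"
      using c by (auto simp: c'_def)
    ultimately show ?thesis
      by blast
  qed
qed

definition clinear_functional :: "('h::complex_hilbert \<Rightarrow> complex) \<Rightarrow> bool" where
  "clinear_functional \<phi> \<longleftrightarrow>
     (\<forall>x y. \<phi> (x + y) = \<phi> x + \<phi> y) \<and> (\<forall>a x. \<phi> (scaleC a x) = a * \<phi> x)"

lemma clinear_functional_sum:
  assumes "clinear_functional \<phi>"
  shows "\<phi> (\<Sum>i\<in>F. scaleC (c i) (f i)) = (\<Sum>i\<in>F. c i * \<phi> (f i))"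
proof -
  have "\<phi> 0 = 0"
    using assms unfolding clinear_functional_def by (metis add_cancel_right_right)
  then show ?thesis
    using assms by (induction F rule: infinite_finite_induct) (auto simp: clinear_functional_def)
qed

text \<open>The Gelfand numbers of \<open>T\<close> are \<open>O(D\<^sub>m \<eta>)\<close> for some \<open>m\<close>. Describing subspaces of finite
  codimension by functionals, rather than by orthogonality, makes closure under composition
  on the right independent of adjoints.\<close>

definition gelfand_dominated :: "(nat \<Rightarrow> real) \<Rightarrow> ('h::complex_hilbert \<Rightarrow> 'h) set" where
  "gelfand_dominated \<eta> = {T. bounded_clinear T \<and> (\<exists>m C. 0 \<le> C \<and> (\<forall>n. \<exists>\<Phi>.
     finite \<Phi> \<and> card \<Phi> \<le> m * n \<and> (\<forall>\<phi>\<in>\<Phi>. clinear_functional \<phi>) \<and>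
     (\<forall>x. (\<forall>\<phi>\<in>\<Phi>. \<phi> x = 0) \<longrightarrow> norm (T x) \<le> C * \<eta> n * norm x)))}"

lemma gelfand_dominatedE:
  assumes "T \<in> gelfand_dominated \<eta>"
  obtains m C \<Phi> where "0 \<le> C" "\<And>n. finite (\<Phi> n)" "\<And>n. card (\<Phi> n) \<le> m * n"
    "\<And>n \<phi>. \<phi> \<in> \<Phi> n \<Longrightarrow> clinear_functional \<phi>"
    "\<And>n x. \<forall>\<phi>\<in>\<Phi> n. \<phi> x = 0 \<Longrightarrow> norm (T x) \<le> C * \<eta> n * norm x"
proof -
  from assms obtain m C where C: "0 \<le> C" and ex: "\<forall>n. \<exists>\<Phi>. finite \<Phi> \<and> card \<Phi> \<le> m * n \<and>
      (\<forall>\<phi>\<in>\<Phi>. clinear_functional \<phi>) \<and>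
      (\<forall>x. (\<forall>\<phi>\<in>\<Phi>. \<phi> x = 0) \<longrightarrow> norm (T x) \<le> C * \<eta> n * norm x)"
    unfolding gelfand_dominated_def by blast
  from choice[OF ex] obtain \<Phi> where "\<forall>n. finite (\<Phi> n) \<and> card (\<Phi> n) \<le> m * n \<and>
      (\<forall>\<phi>\<in>\<Phi> n. clinear_functional \<phi>) \<and>
      (\<forall>x. (\<forall>\<phi>\<in>\<Phi> n. \<phi> x = 0) \<longrightarrow> norm (T x) \<le> C * \<eta> n * norm x)" ..
  with C show ?thesis
    by (intro that[of C \<Phi> m]) simp_all
qed

lemma gelfand_dominatedI:
  assumes "bounded_clinear T" "0 \<le> C" "\<And>n. finite (\<Phi> n)" "\<And>n. card (\<Phi> n) \<le> m * n"
    "\<And>n \<phi>. \<phi> \<in> \<Phi> n \<Longrightarrow> clinear_functional \<phi>"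
    "\<And>n x. \<forall>\<phi>\<in>\<Phi> n. \<phi> x = 0 \<Longrightarrow> norm (T x) \<le> C * \<eta> n * norm x"
  shows "T \<in> gelfand_dominated \<eta>"
proof -
  have "\<exists>\<Phi>. finite \<Phi> \<and> card \<Phi> \<le> m * n \<and> (\<forall>\<phi>\<in>\<Phi>. clinear_functional \<phi>) \<and>
      (\<forall>x. (\<forall>\<phi>\<in>\<Phi>. \<phi> x = 0) \<longrightarrow> norm (T x) \<le> C * \<eta> n * norm x)" for n
    using assms(3-6) by (intro exI[of _ "\<Phi> n"]) simp
  with assms(1,2) show ?thesis
    unfolding gelfand_dominated_def by blast
qed

text \<open>Imposing both families of functionals makes both estimates available; the codimensions
  add, which is harmless because the factor \<open>m\<close> is free.\<close>

lemma gelfand_dominated_add: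
  assumes "S \<in> gelfand_dominated \<eta>" "T \<in> gelfand_dominated \<eta>"
  shows "(\<lambda>x. S x + T x) \<in> gelfand_dominated \<eta>"
proof -
  obtain m C \<Phi> where 1: "0 \<le> C" "\<And>n. finite (\<Phi> n)" "\<And>n. card (\<Phi> n) \<le> m * n"
    "\<And>n \<phi>. \<phi> \<in> \<Phi> n \<Longrightarrow> clinear_functional \<phi>"
    "\<And>n x. \<forall>\<phi>\<in>\<Phi> n. \<phi> x = 0 \<Longrightarrow> norm (S x) \<le> C * \<eta> n * norm x"
    using assms(1) by (rule gelfand_dominatedE) (rule that)
  obtain m' C' \<Psi> where 2: "0 \<le> C'" "\<And>n. finite (\<Psi> n)" "\<And>n. card (\<Psi> n) \<le> m' * n"
    "\<And>n \<phi>. \<phi> \<in> \<Psi> n \<Longrightarrow> clinear_functional \<phi>"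
    "\<And>n x. \<forall>\<phi>\<in>\<Psi> n. \<phi> x = 0 \<Longrightarrow> norm (T x) \<le> C' * \<eta> n * norm x"
    using assms(2) by (rule gelfand_dominatedE) (rule that)
  show ?thesis
  proof (rule gelfand_dominatedI[where C = "C + C'" and m = "m + m'" and \<Phi> = "\<lambda>n. \<Phi> n \<union> \<Psi> n"])
    show "bounded_clinear (\<lambda>x. S x + T x)"
      using assms by (intro bounded_clinear_add) (simp_all add: gelfand_dominated_def)
    show "card (\<Phi> n \<union> \<Psi> n) \<le> (m + m') * n" for n
      using card_Un_le[of "\<Phi> n" "\<Psi> n"] 1(3)[of n] 2(3)[of n] by (simp add: add_mult_distrib)
    show "norm (S x + T x) \<le> (C + C') * \<eta> n * norm x" if "\<forall>\<phi>\<in>\<Phi> n \<union> \<Psi> n. \<phi> x = 0" for n x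
      using norm_triangle_ineq[of "S x" "T x"] 1(5)[of n x] 2(5)[of n x] that
      by (simp add: algebra_simps)
  qed (use 1 2 in auto)
qed

lemma gelfand_dominated_left:
  assumes "T \<in> gelfand_dominated \<eta>" "bounded_clinear S"
  shows "S \<circ> T \<in> gelfand_dominated \<eta>"
proof -
  obtain m C \<Phi> where 1: "0 \<le> C" "\<And>n. finite (\<Phi> n)" "\<And>n. card (\<Phi> n) \<le> m * n"
    "\<And>n \<phi>. \<phi> \<in> \<Phi> n \<Longrightarrow> clinear_functional \<phi>"
    "\<And>n x. \<forall>\<phi>\<in>\<Phi> n. \<phi> x = 0 \<Longrightarrow> norm (T x) \<le> C * \<eta> n * norm x"
    using assms(1) by (rule gelfand_dominatedE) (rule that)
  obtain K where K: "0 \<le> K" "\<And>x. norm (S x) \<le> norm x * K"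
    using assms(2) bounded_linear.nonneg_bounded unfolding bounded_clinear_def by blast
  show ?thesis
  proof (rule gelfand_dominatedI[where C = "C * K" and m = m and \<Phi> = \<Phi>])
    show "bounded_clinear (S \<circ> T)"
      using assms by (intro bounded_clinear_compose) (simp_all add: gelfand_dominated_def)
    show "norm ((S \<circ> T) x) \<le> C * K * \<eta> n * norm x" if "\<forall>\<phi>\<in>\<Phi> n. \<phi> x = 0" for n x
      using order_trans[OF K(2) mult_right_mono[OF 1(5) K(1)]] that by (simp add: mult_ac)
  qed (use 1 K in auto)
qed

text \<open>The functionals are pulled back along \<open>S\<close>, which does not increase their
  number.\<close>

lemma gelfand_dominated_right:
  assumes "T \<in> gelfand_dominated \<eta>" "bounded_clinear S" and \<eta>: "\<And>n. 0 \<le> \<eta> n"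
  shows "T \<circ> S \<in> gelfand_dominated \<eta>"
proof -
  obtain m C \<Phi> where 1: "0 \<le> C" "\<And>n. finite (\<Phi> n)" "\<And>n. card (\<Phi> n) \<le> m * n"
    "\<And>n \<phi>. \<phi> \<in> \<Phi> n \<Longrightarrow> clinear_functional \<phi>"
    "\<And>n x. \<forall>\<phi>\<in>\<Phi> n. \<phi> x = 0 \<Longrightarrow> norm (T x) \<le> C * \<eta> n * norm x"
    using assms(1) by (rule gelfand_dominatedE) (rule that)
  have S: "bounded_linear S" "\<And>a x. S (scaleC a x) = scaleC a (S x)"
    using assms(2) by (auto simp: bounded_clinear_def)
  obtain K where K: "0 \<le> K" "\<And>x. norm (S x) \<le> norm x * K"
    using bounded_linear.nonneg_bounded[OF S(1)] by blast
  show ?thesis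
  proof (rule gelfand_dominatedI[where C = "C * K" and m = m and \<Phi> = "\<lambda>n. (\<lambda>\<phi>. \<phi> \<circ> S) ` \<Phi> n"])
    show "bounded_clinear (T \<circ> S)"
      using assms by (intro bounded_clinear_compose) (simp_all add: gelfand_dominated_def)
    show "card ((\<lambda>\<phi>. \<phi> \<circ> S) ` \<Phi> n) \<le> m * n" for n
      using card_image_le[OF 1(2), of "\<lambda>\<phi>. \<phi> \<circ> S" n] 1(3)[of n] by simp
    show "clinear_functional \<phi>" if "\<phi> \<in> (\<lambda>\<phi>. \<phi> \<circ> S) ` \<Phi> n" for n \<phi>
      using that 1(4) S by (auto simp: clinear_functional_def linear_add bounded_linear.linear)
    show "norm ((T \<circ> S) x) \<le> C * K * \<eta> n * norm x"
      if "\<forall>\<phi>\<in>(\<lambda>\<phi>. \<phi> \<circ> S) ` \<Phi> n. \<phi> x = 0" for n x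
    proof -
      have "norm (T (S x)) \<le> C * \<eta> n * norm (S x)"
        using that by (intro 1(5)) force
      also have "\<dots> \<le> C * \<eta> n * (norm x * K)"
        using 1(1) \<eta> K by (intro mult_left_mono) auto
      finally show ?thesis
        by (simp add: mult_ac)
    qed
  qed (use 1 K in auto)
qed

lemma ideal_gelfand_dominated:
  assumes \<eta>: "\<And>n. 0 \<le> \<eta> n"
  shows "ideal (gelfand_dominated \<eta> :: ('h::complex_hilbert \<Rightarrow> 'h) set) BH"
proof (rule idealI[OF ring_BH])
  interpret ring "BH :: ('h \<Rightarrow> 'h) ring"
    by (rule ring_BH)
  have l: "S \<otimes>\<^bsub>BH\<^esub> T \<in> gelfand_dominated \<eta>"
    if "T \<in> gelfand_dominated \<eta>" "S \<in> carrier BH" for S T :: "'h \<Rightarrow> 'h"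
    using that gelfand_dominated_left by (simp add: BH_def)
  have sub: "gelfand_dominated \<eta> \<subseteq> carrier (BH :: ('h \<Rightarrow> 'h) ring)"
    by (auto simp: gelfand_dominated_def BH_def)
  show "subgroup (gelfand_dominated \<eta>) (add_monoid (BH :: ('h \<Rightarrow> 'h) ring))"
  proof (rule add.subgroupI)
    have "(\<lambda>x. 0) \<in> (gelfand_dominated \<eta> :: ('h \<Rightarrow> 'h) set)"
      by (rule gelfand_dominatedI[where C = 0 and m = 0 and \<Phi> = "\<lambda>_. {}"])
         (auto simp: bounded_clinear_zero)
    then show "gelfand_dominated \<eta> \<noteq> ({} :: ('h \<Rightarrow> 'h) set)"
      by blast
    \<comment> \<open>Negation is left multiplication by minus the identity, so the left ideal
      property covers it.\<close>
    show "\<ominus>\<^bsub>BH\<^esub> T \<in> gelfand_dominated \<eta>" if "T \<in> gelfand_dominated \<eta>" for T :: "'h \<Rightarrow> 'h"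
      using l[OF that, of "\<ominus>\<^bsub>BH\<^esub> \<one>\<^bsub>BH\<^esub>"] that sub by (auto simp: l_minus)
    show "S \<oplus>\<^bsub>BH\<^esub> T \<in> gelfand_dominated \<eta>"
      if "S \<in> gelfand_dominated \<eta>" "T \<in> gelfand_dominated \<eta>" for S T :: "'h \<Rightarrow> 'h"
      using gelfand_dominated_add[OF that] by (simp add: BH_def)
  qed (rule sub)
  show "S \<otimes>\<^bsub>BH\<^esub> T \<in> gelfand_dominated \<eta>"
    if "T \<in> gelfand_dominated \<eta>" "S \<in> carrier BH" for S T :: "'h \<Rightarrow> 'h"
    using l that by blast
  show "T \<otimes>\<^bsub>BH\<^esub> S \<in> gelfand_dominated \<eta>"
    if "T \<in> gelfand_dominated \<eta>" "S \<in> carrier BH" for S T :: "'h \<Rightarrow> 'h"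
    using that gelfand_dominated_right[OF _ _ \<eta>] by (simp add: BH_def)
qed

text \<open>The functionals are the first \<open>n\<close> coordinates: on their common kernel only
  weights \<open>\<eta> i\<close> with \<open>n \<le> i\<close> act, and these are at most
  \<open>\<eta> n\<close>.\<close>

lemma diag_op_gelfand_dominated:
  assumes on: "orthonormal_seq e" and \<eta>: "\<eta> \<in> c0star"
  shows "diag_op e \<eta> \<in> gelfand_dominated \<eta>"
proof (rule gelfand_dominatedI[where C = 1 and m = 1 and \<Phi> = "\<lambda>n. (\<lambda>i x. cinner x (e i)) ` {..<n}"])
  show "bounded_clinear (diag_op e \<eta>)"
    using assms by (rule bounded_clinear_diag_op)
  show "card ((\<lambda>i x. cinner x (e i)) ` {..<n}) \<le> 1 * n" for n
    using card_image_le[of "{..<n}" "\<lambda>i x. cinner x (e i)"] by simp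
  show "norm (diag_op e \<eta> x) \<le> 1 * \<eta> n * norm x"
    if x: "\<forall>\<phi>\<in>(\<lambda>i x. cinner x (e i)) ` {..<n}. \<phi> x = 0" for n x
  proof -
    have "cmod (complex_of_real (\<eta> i)) \<le> \<eta> n" if "cinner x (e i) \<noteq> 0" for i
    proof -
      have "n \<le> i"
        using that x by force
      then show ?thesis
        using \<eta> by (simp add: c0star_def decseq_def)
    qed
    moreover have "0 \<le> \<eta> n"
      using \<eta> by (simp add: c0star_def)
    ultimately show ?thesis
      using norm_weighted_op_le[OF on on] by (simp add: diag_op_eq_weighted_op)
  qed
qed (auto simp: clinear_functional_def cinner_add_left cinner_scaleC_left)

text \<open>By dimension count the functionals have a common nonzero zero in the span of
  sufficiently many eigenvectors of the modulus. On that span \<open>T\<close> expands norms by at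
  least the smallest eigenvalue involved, so the Gelfand bound applies to that eigenvalue.\<close>

lemma s_numbers_gelfand_dominated:
  fixes T :: "'h::complex_hilbert \<Rightarrow> 'h"
  assumes T: "T \<in> gelfand_dominated \<eta>" and s: "s_numbers T \<rho>"
  obtains m C where "m > 0" "\<And>n. \<rho> n \<le> C * \<eta> (n div m)"
proof -
  obtain m C \<Phi> where \<Phi>: "0 \<le> C" "\<And>n. finite (\<Phi> n)" "\<And>n. card (\<Phi> n) \<le> m * n"
    "\<And>n \<phi>. \<phi> \<in> \<Phi> n \<Longrightarrow> clinear_functional \<phi>"
    "\<And>n x. \<forall>\<phi>\<in>\<Phi> n. \<phi> x = 0 \<Longrightarrow> norm (T x) \<le> C * \<eta> n * norm x"
    using T by (rule gelfand_dominatedE) (rule that)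
  obtain P f S where \<rho>: "\<rho> \<in> c0star" and P: "bounded_clinear P" and S: "adjoint_of T S"
    and PP: "P \<circ> P = S \<circ> T" and f: "orthonormal_seq f"
    and Pf: "\<And>n. P (f n) = scaleC (complex_of_real (\<rho> n)) (f n)"
    using s unfolding s_numbers_def modulus_of_def positive_op_def by blast
  have P_sum: "P (\<Sum>i\<in>F. scaleC (c i) (f i)) = (\<Sum>i\<in>F. scaleC (c i * complex_of_real (\<rho> i)) (f i))" for F c
    using P unfolding bounded_clinear_def
    by (simp add: linear_sum bounded_linear.linear Pf scaleC_scaleC)
  have pos: "0 \<le> \<rho> n" for n
    using \<rho> by (simp add: c0star_def)
  have dec: "\<rho> j \<le> \<rho> i" if "i \<le> j" for i j
    using \<rho> that by (simp add: c0star_def decseq_def)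
  \<comment> \<open>\<open>Suc m\<close> replaces \<open>m\<close> because \<open>m\<close> may be
    0, while the divisor obtained at the end has to be positive.\<close>
  have key: "\<rho> (Suc m * n) \<le> C * \<eta> n" for n
  proof -
    define N where "N = Suc m * n"
    have "card (\<Phi> n) < card {..N}"
      using \<Phi>(3)[of n] by (simp add: N_def)
    from underdetermined_system[OF \<Phi>(2) _ this, of "\<lambda>\<phi> i. \<phi> (f i)"]
    obtain c i where c: "i \<le> N" "c i \<noteq> 0" "\<forall>\<phi>\<in>\<Phi> n. (\<Sum>i\<le>N. c i * \<phi> (f i)) = 0"
      by auto
    define x where "x = (\<Sum>i\<le>N. scaleC (c i) (f i))"
    have nx: "(norm x)\<^sup>2 = (\<Sum>i\<le>N. (cmod (c i))\<^sup>2)"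
      unfolding x_def by (intro norm_orthonormal_sum f) simp
    have "(norm x)\<^sup>2 > 0"
      unfolding nx using c by (intro sum_pos2[of _ i]) auto
    then have x0: "norm x > 0"
      by simp
    have "norm (T x) \<le> C * \<eta> n * norm x"
      by (rule \<Phi>(5)) (simp add: x_def clinear_functional_sum[OF \<Phi>(4)] c)
    moreover have "\<rho> N * norm x \<le> norm (T x)"
    proof (rule power2_le_imp_le)
      \<comment> \<open>Replacing \<open>S \<circ> T\<close> by \<open>P \<circ> P\<close> expresses
        the norm of \<open>T x\<close> through the eigenvalues \<open>\<rho> i\<close> with
        \<open>i \<le> N\<close>, each at least \<open>\<rho> N\<close>.\<close>
      have "complex_of_real ((norm (T x))\<^sup>2) = cinner x (S (T x))"
        using S unfolding adjoint_of_def cinner_self[symmetric] by blast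
      also have "S (T x) = P (P x)"
        using PP by (metis comp_apply)
      also have "cinner x (P (P x)) =
          (\<Sum>i\<le>N. c i * cnj (c i * complex_of_real (\<rho> i) * complex_of_real (\<rho> i)))"
        unfolding x_def P_sum by (intro cinner_orthonormal_sum f) simp
      also have "\<dots> = complex_of_real (\<Sum>i\<le>N. (\<rho> i)\<^sup>2 * (cmod (c i))\<^sup>2)"
        unfolding of_real_sum of_real_mult complex_norm_square
        by (intro sum.cong) (simp_all add: power2_eq_square mult_ac)
      finally have "(norm (T x))\<^sup>2 = (\<Sum>i\<le>N. (\<rho> i)\<^sup>2 * (cmod (c i))\<^sup>2)"
        by (simp only: of_real_eq_iff)
      also have "\<dots> \<ge> (\<Sum>i\<le>N. (\<rho> N)\<^sup>2 * (cmod (c i))\<^sup>2)"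
        by (intro sum_mono mult_right_mono power_mono dec pos) auto
      finally show "(\<rho> N * norm x)\<^sup>2 \<le> (norm (T x))\<^sup>2"
        by (simp add: power_mult_distrib nx sum_distrib_left)
    qed simp
    ultimately have "\<rho> N * norm x \<le> C * \<eta> n * norm x"
      by simp
    then show ?thesis
      using x0 by (simp add: N_def)
  qed
  \<comment> \<open>Monotonicity of \<open>\<rho>\<close> extends the bound from multiples of
    \<open>Suc m\<close> to every index.\<close>
  have "\<rho> n \<le> C * \<eta> (n div Suc m)" for n
    using order_trans[OF dec[OF times_div_less_eq_dividend] key] .
  then show ?thesis
    using that by blast
qed

text \<open>With indices counted from 0, \<open>D\<^sub>m \<eta>\<close> is \<open>\<lambda>n. \<eta> (n div m)\<close>.\<close>

lemma mem_char_set_principal_ideal_iff: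
  assumes e: "orthonormal_basis e" and \<eta>: "\<eta> \<in> c0star" and \<rho>: "\<rho> \<in> c0star"
  shows "\<rho> \<in> char_set (principal_ideal e \<eta>) \<longleftrightarrow> (\<exists>m>0. \<exists>C. \<forall>n. \<rho> n \<le> C * \<eta> (n div m))"
proof
  assume "\<rho> \<in> char_set (principal_ideal e \<eta>)"
  then obtain T where T: "T \<in> principal_ideal e \<eta>" and s: "s_numbers T \<rho>"
    by (auto simp: char_set_def)
  have "ideal (gelfand_dominated \<eta> :: ('a \<Rightarrow> 'a) set) BH"
    using \<eta> by (intro ideal_gelfand_dominated) (simp add: c0star_def)
  moreover have "diag_op e \<eta> \<in> gelfand_dominated \<eta>"
    using e \<eta> by (simp add: diag_op_gelfand_dominated orthonormal_basis_def)
  ultimately have "T \<in> gelfand_dominated \<eta>"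
    using T by (auto simp: principal_ideal_def genideal_def)
  from this s show "\<exists>m>0. \<exists>C. \<forall>n. \<rho> n \<le> C * \<eta> (n div m)"
    by (rule s_numbers_gelfand_dominated) blast
next
  assume "\<exists>m>0. \<exists>C. \<forall>n. \<rho> n \<le> C * \<eta> (n div m)"
  then show "\<rho> \<in> char_set (principal_ideal e \<eta>)"
    using diag_op_in_principal_ideal[OF e \<rho> \<eta>] s_numbers_diag_op[OF e \<rho>]
    by (auto simp: char_set_def)
qed

section \<open>Arithmetic means and the sequence \<open>hat \<xi>\<close>\<close>

lemma c0star_nonneg: "\<xi> \<in> c0star \<Longrightarrow> 0 \<le> \<xi> n"
  by (simp add: c0star_def)

lemma c0star_antimono: "\<xi> \<in> c0star \<Longrightarrow> m \<le> n \<Longrightarrow> \<xi> n \<le> \<xi> m"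
  by (simp add: c0star_def decseq_def)

lemma sum_le_split:
  assumes "\<eta> \<in> c0star" "m \<le> k"
  shows "(\<Sum>i<k. \<eta> i) \<le> (\<Sum>i<m. \<eta> i) + real (k - m) * \<eta> m"
proof -
  have "{..<k} = {..<m} \<union> {m..<k}"
    using assms(2) by auto
  then have "(\<Sum>i<k. \<eta> i) = (\<Sum>i<m. \<eta> i) + (\<Sum>i=m..<k. \<eta> i)"
    by (simp add: sum.union_disjoint ivl_disj_int)
  also have "(\<Sum>i=m..<k. \<eta> i) \<le> (\<Sum>i=m..<k. \<eta> m)"
    using assms(1) by (intro sum_mono c0star_antimono) auto
  finally show ?thesis
    by simp
qed

lemma sum_eq_arith_mean: "1 \<le> k \<Longrightarrow> (\<Sum>i<k. \<eta> i) = real k * arith_mean \<eta> (k - 1)"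
  by (cases k) (auto simp: arith_mean_def lessThan_Suc_atMost)

text \<open>A new term is at most each earlier one, hence at most their mean. Convergence is the
  Cesaro argument: terms from \<open>N\<close> on are at most \<open>r / 2\<close>, and past
  \<open>M\<close> the first \<open>N\<close> terms contribute less than \<open>r / 2\<close> to the
  mean.\<close>

lemma arith_mean_c0star:
  assumes \<eta>: "\<eta> \<in> c0star"
  shows "arith_mean \<eta> \<in> c0star"
proof -
  note nonneg = c0star_nonneg[OF \<eta>]
  have nn: "0 \<le> arith_mean \<eta> n" for n
    by (simp add: arith_mean_def sum_nonneg nonneg)
  have "decseq (arith_mean \<eta>)"
  proof (rule decseq_SucI)
    fix n
    have "(\<Sum>j\<le>n. \<eta> (Suc n)) \<le> (\<Sum>j\<le>n. \<eta> j)"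
      by (intro sum_mono c0star_antimono[OF \<eta>]) auto
    then show "arith_mean \<eta> (Suc n) \<le> arith_mean \<eta> n"
      by (simp add: arith_mean_def divide_simps) (simp add: algebra_simps)
  qed
  moreover have "arith_mean \<eta> \<longlonglongrightarrow> 0"
  proof (rule LIMSEQ_I)
    fix r :: real assume r: "0 < r"
    have "\<eta> \<longlonglongrightarrow> 0"
      using \<eta> by (simp add: c0star_def)
    then obtain N where "norm (\<eta> N - 0) < r / 2"
      using LIMSEQ_D[of \<eta> 0 "r / 2"] r by auto
    then have N: "\<eta> N \<le> r / 2"
      by simp
    obtain M where M: "(\<Sum>i<N. \<eta> i) < real M * (r / 2)"
      using reals_Archimedean3[of "r / 2"] r by auto
    have "norm (arith_mean \<eta> n - 0) < r" if n: "n \<ge> max N M" for n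
    proof -
      have "(\<Sum>i\<le>n. \<eta> i) \<le> (\<Sum>i<N. \<eta> i) + real (Suc n - N) * \<eta> N"
        using sum_le_split[OF \<eta>, of N "Suc n"] n by (simp add: lessThan_Suc_atMost)
      also have "real (Suc n - N) * \<eta> N \<le> real (Suc n) * (r / 2)"
        using N nonneg by (intro mult_mono) auto
      finally have "(\<Sum>i\<le>n. \<eta> i) < real (Suc n) * r"
        using M n r mult_right_mono[of "real M" "real (Suc n)" "r / 2"] by (simp add: field_simps)
      then show ?thesis
        using nonneg by (simp add: arith_mean_def divide_less_eq mult.commute sum_nonneg)
    qed
    then show "\<exists>no. \<forall>n\<ge>no. norm (arith_mean \<eta> n - 0) < r"
      by blast
  qed
  ultimately show ?thesis
    using nn by (simp add: c0star_def)
qed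

section \<open>The counting function \<open>nu\<close> and the sequence \<open>hat\<close>\<close>

context
  fixes \<xi> :: "nat \<Rightarrow> real"
  assumes \<xi>: "\<xi> \<in> c0star" and not_summable: "\<not> summable \<xi>"
begin

lemma first_term_pos: "0 < \<xi> 0"
proof (rule ccontr)
  assume "\<not> 0 < \<xi> 0"
  then have "\<xi> n = 0" for n
    using c0star_nonneg[OF \<xi>, of n] c0star_antimono[OF \<xi>, of 0 n] by simp
  then have "\<xi> = (\<lambda>_. 0)"
    by (rule ext)
  with not_summable show False
    by simp
qed

lemma nu_exists: "\<exists>k. 1 \<le> k \<and> (\<Sum>i<k. \<xi> i) \<ge> real n * \<xi> 0"
proof -
  have "\<not> (\<forall>k. (\<Sum>i<k. \<xi> i) \<le> real n * \<xi> 0)"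
    using summableI_nonneg_bounded[of \<xi> "real n * \<xi> 0"] c0star_nonneg[OF \<xi>] not_summable by blast
  then obtain k where "real n * \<xi> 0 < (\<Sum>i<k. \<xi> i)"
    by (auto simp: not_le)
  then show ?thesis
    using c0star_nonneg[OF \<xi>, of k] by (intro exI[of _ "Suc k"]) simp
qed

lemma nu_ge_1: "1 \<le> nu \<xi> n"
  and sum_nu_ge: "real n * \<xi> 0 \<le> (\<Sum>i<nu \<xi> n. \<xi> i)"
  using LeastI_ex[OF nu_exists[of n]] unfolding nu_def by blast+

text \<open>For positive \<open>k\<close> this is the minimality of \<open>nu\<close>; at
  \<open>k = 0\<close>, excluded from the minimum, the sum is empty.\<close>

lemma sum_less_nu_le: "k < nu \<xi> n \<Longrightarrow> (\<Sum>i<k. \<xi> i) \<le> real n * \<xi> 0"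
  using not_less_Least[of k "\<lambda>k. 1 \<le> k \<and> (\<Sum>i<k. \<xi> i) \<ge> real n * \<xi> 0"] first_term_pos
  unfolding nu_def[symmetric] by (cases "k = 0") simp_all

lemma sum_le_mult_first: "(\<Sum>i<k. \<xi> i) \<le> real k * \<xi> 0"
  using sum_bounded_above[of "{..<k}" \<xi> "\<xi> 0"] c0star_antimono[OF \<xi>] by simp

lemma le_nu: "n \<le> nu \<xi> n"
  using order_trans[OF sum_nu_ge[of n] sum_le_mult_first] first_term_pos by simp

lemma nu_mono: "m \<le> n \<Longrightarrow> nu \<xi> m \<le> nu \<xi> n"
  unfolding nu_def[of \<xi> m]
  using nu_ge_1 order_trans[OF mult_right_mono sum_nu_ge] first_term_pos
  by (intro Least_le conjI) (simp_all add: less_imp_le)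

lemma sum_nu_eq: "(\<Sum>i<nu \<xi> (Suc n). \<xi> i) = real (nu \<xi> (Suc n)) * hat \<xi> n"
  unfolding hat_def by (rule sum_eq_arith_mean[OF nu_ge_1])

lemma sum_le_mult_hat:
  assumes "nu \<xi> (Suc n) \<le> k"
  shows "(\<Sum>i<k. \<xi> i) \<le> real k * hat \<xi> n"
proof -
  have "1 \<le> k"
    using assms nu_ge_1 order_trans by blast
  moreover have "arith_mean \<xi> (k - 1) \<le> hat \<xi> n"
    unfolding hat_def using assms by (intro c0star_antimono[OF arith_mean_c0star[OF \<xi>]]) simp
  ultimately show ?thesis
    by (simp add: sum_eq_arith_mean mult_left_mono)
qed

lemma hat_pos: "0 < hat \<xi> n"
proof -
  have "0 < real (Suc n) * \<xi> 0"
    using first_term_pos by simp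
  also note sum_nu_ge
  finally show ?thesis
    by (simp add: sum_nu_eq zero_less_mult_iff)
qed

lemma hat_0: "hat \<xi> 0 = \<xi> 0"
proof -
  have "nu \<xi> (Suc 0) \<le> 1"
    unfolding nu_def by (rule Least_le) simp
  then show ?thesis
    by (simp add: hat_def arith_mean_def)
qed

lemma hat_c0star: "hat \<xi> \<in> c0star"
proof -
  note am = arith_mean_c0star[OF \<xi>]
  have "decseq (hat \<xi>)"
    unfolding hat_def decseq_def by (auto intro!: c0star_antimono[OF am] diff_le_mono nu_mono)
  moreover have "hat \<xi> \<longlonglongrightarrow> 0"
  \<comment> \<open>Since \<open>Suc n \<le> nu \<xi> (Suc n)\<close>, the value
    \<open>hat \<xi> n\<close> is a mean over at least \<open>Suc n\<close> terms, hence at most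
    \<open>arith_mean \<xi> n\<close>.\<close>
  proof (rule tendsto_sandwich[OF _ _ tendsto_const])
    show "arith_mean \<xi> \<longlonglongrightarrow> 0"
      using am by (simp add: c0star_def)
    show "\<forall>\<^sub>F n in sequentially. hat \<xi> n \<le> arith_mean \<xi> n"
      unfolding hat_def
      by (intro always_eventually allI c0star_antimono[OF am]) (metis le_nu diff_Suc_1 diff_le_mono)
    show "\<forall>\<^sub>F n in sequentially. 0 \<le> hat \<xi> n"
      using hat_pos by (intro always_eventually allI less_imp_le)
  qed
  ultimately show ?thesis
    using hat_pos by (simp add: c0star_def less_imp_le)
qed

section \<open>Asymptotic minimality of \<open>hat\<close> and the escaping majorants\<close>

lemma hat_minimal:
  assumes \<eta>: "\<eta> \<in> c0star" and le: "\<And>n. arith_mean \<xi> n \<le> arith_mean \<eta> n" and \<epsilon>: "0 < \<epsilon>"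
  shows "\<forall>\<^sub>F n in sequentially. (1 - \<epsilon>) * hat \<xi> n \<le> \<eta> n"
proof -
  have "arith_mean \<eta> \<longlonglongrightarrow> 0"
    using arith_mean_c0star[OF \<eta>] by (simp add: c0star_def)
  \<comment> \<open>The threshold is chosen so that the first \<open>Suc n\<close> terms of \<eta>
    sum to at most \<epsilon> times \<open>Suc n * \<xi> 0\<close>, hence to at most \<epsilon>
    times the sum of \<xi> up to \<open>nu\<close>. Moving that share to the left produces the
    factor \<open>1 - \<epsilon>\<close>.\<close>
  then have "\<forall>\<^sub>F n in sequentially. arith_mean \<eta> n < \<epsilon> * \<xi> 0"
    using \<epsilon> first_term_pos by (intro order_tendstoD) auto
  then show ?thesis
  proof eventually_elim
    case (elim n)
    define k where "k = nu \<xi> (Suc n)"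
    have k: "Suc n \<le> k" "real k > 0"
      using le_nu[of "Suc n"] nu_ge_1[of "Suc n"] by (auto simp: k_def)
    have "(\<Sum>i<k. \<xi> i) \<le> (\<Sum>i<k. \<eta> i)"
      using k le by (simp add: sum_eq_arith_mean mult_left_mono)
    also have "\<dots> \<le> (\<Sum>i<Suc n. \<eta> i) + real (k - Suc n) * \<eta> (Suc n)"
      by (rule sum_le_split[OF \<eta> k(1)])
    also have "(\<Sum>i<Suc n. \<eta> i) \<le> real (Suc n) * (\<epsilon> * \<xi> 0)"
      using elim by (subst sum_eq_arith_mean) (auto intro!: mult_left_mono)
    also have "\<dots> = \<epsilon> * (real (Suc n) * \<xi> 0)"
      by (simp add: mult_ac)
    also have "\<dots> \<le> \<epsilon> * (\<Sum>i<k. \<xi> i)"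
      unfolding k_def using \<epsilon> by (intro mult_left_mono sum_nu_ge) simp
    also have "real (k - Suc n) * \<eta> (Suc n) \<le> real k * \<eta> n"
      using c0star_nonneg[OF \<eta>] c0star_antimono[OF \<eta>] by (intro mult_mono) auto
    finally have "(1 - \<epsilon>) * (\<Sum>i<k. \<xi> i) \<le> real k * \<eta> n"
      by (simp add: algebra_simps)
    then have "real k * ((1 - \<epsilon>) * hat \<xi> n) \<le> real k * \<eta> n"
      by (simp add: k_def sum_nu_eq mult_ac)
    then show ?case
      using k(2) by simp
  qed
qed

text \<open>The index \<open>q'\<close> is \<open>p' div L\<close> with \<open>L\<close> so large that the constant \<open>hat \<xi> q\<close>, summed over
  \<open>p'\<close> indices, exceeds all partial sums of \<open>\<xi>\<close> before \<open>nu \<xi> (Suc q')\<close>. Since \<open>L\<close> depends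
  on \<open>q\<close>, \<open>\<rho>\<close> has to escape \<open>D\<^sub>m (hat \<xi>)\<close> for every \<open>m\<close>.\<close>

lemma escape_step:
  assumes \<rho>: "\<rho> \<in> c0star" and esc: "\<And>m C. m > 0 \<Longrightarrow> \<exists>n. C * hat \<xi> (n div m) < \<rho> n"
  shows "\<exists>p' q' n. p < p' \<and> hat \<xi> q' \<le> hat \<xi> q / 2 \<and> real (Suc q') * \<xi> 0 \<le> real p' * hat \<xi> q \<and>
           n div Suc j = p' \<and> real (Suc j) * hat \<xi> q' < \<rho> n"
proof -
  note hat_anti = c0star_antimono[OF hat_c0star]
  \<comment> \<open>The factor 2 absorbs the passage from \<open>q'\<close> to
    \<open>Suc q'\<close>, as \<open>q'\<close> will be positive.\<close>
  obtain L where L: "2 * \<xi> 0 < real L * hat \<xi> q"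
    using reals_Archimedean3[OF hat_pos] by blast
  have L0: "L > 0"
    using L first_term_pos by (cases L) auto
  \<comment> \<open>Division by \<open>m\<close> is division by \<open>Suc j\<close> followed by
    division by \<open>L\<close>, so one index \<open>n\<close> determines both \<open>p'\<close>
    and \<open>q'\<close>.\<close>
  define m where "m = Suc j * L"
  have m: "m > 0"
    using L0 by (simp add: m_def)
  have "hat \<xi> \<longlonglongrightarrow> 0"
    using hat_c0star by (simp add: c0star_def)
  then have "\<forall>\<^sub>F n in sequentially. hat \<xi> n < hat \<xi> q / 2"
    using hat_pos by (intro order_tendstoD) auto
  then obtain q0 where q0: "\<And>n. q0 \<le> n \<Longrightarrow> hat \<xi> n < hat \<xi> q / 2"
    unfolding eventually_sequentially by blast
  define N where "N = q0 + p + 1"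
  \<comment> \<open>The first entry of the maximum yields the required lower bound on
    \<open>\<rho> n\<close>. The second forces \<open>n div m\<close> beyond \<open>N\<close>, since
    otherwise \<open>\<rho> n\<close> would exceed \<open>\<rho> 0\<close>.\<close>
  obtain n where n: "max (real (Suc j)) (\<rho> 0 / hat \<xi> N) * hat \<xi> (n div m) < \<rho> n"
    using esc[OF m] by blast
  have le_n: "c * hat \<xi> (n div m) < \<rho> n" if "c \<le> max (real (Suc j)) (\<rho> 0 / hat \<xi> N)" for c
    using mult_right_mono[OF that less_imp_le[OF hat_pos]] n by (rule le_less_trans)
  have N: "N \<le> n div m"
  proof (rule ccontr)
    assume "\<not> N \<le> n div m"
    then have "hat \<xi> N \<le> hat \<xi> (n div m)"
      by (intro hat_anti) simp
    then have "\<rho> 0 / hat \<xi> N * hat \<xi> N \<le> \<rho> 0 / hat \<xi> N * hat \<xi> (n div m)"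
      using c0star_nonneg[OF \<rho>, of 0] hat_pos[of N] by (intro mult_left_mono) auto
    then have "\<rho> 0 < \<rho> n"
      using le_n[of "\<rho> 0 / hat \<xi> N"] hat_pos[of N] by simp
    then show False
      using c0star_antimono[OF \<rho>, of 0 n] by simp
  qed
  define p' where "p' = n div Suc j"
  define q' where "q' = p' div L"
  have q': "q' = n div m"
    by (simp only: q'_def p'_def m_def div_mult2_eq)
  have p': "q' * L \<le> p'"
    by (simp add: q'_def)
  have "p < q'"
    using N q' by (simp add: N_def)
  also have "q' \<le> p'"
    unfolding q'_def by (rule div_le_dividend)
  finally have "p < p'" .
  moreover have "hat \<xi> q' \<le> hat \<xi> q / 2"
    using q0[of q'] N q' by (simp add: N_def)
  moreover have "real (Suc q') * \<xi> 0 \<le> real p' * hat \<xi> q"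
  proof -
    have "real (Suc q') * \<xi> 0 \<le> real q' * (2 * \<xi> 0)"
      using \<open>p < q'\<close> first_term_pos by simp
    also have "\<dots> \<le> real q' * (real L * hat \<xi> q)"
      using L by (intro mult_left_mono) auto
    also have "\<dots> = real (q' * L) * hat \<xi> q"
      by simp
    also have "\<dots> \<le> real p' * hat \<xi> q"
      using p' less_imp_le[OF hat_pos] by (intro mult_right_mono) (simp_all only: of_nat_le_iff)
    finally show ?thesis .
  qed
  moreover have "real (Suc j) * hat \<xi> q' < \<rho> n"
    using le_n[of "real (Suc j)"] q' by simp
  ultimately show ?thesis
    using p'_def by blast
qed

lemma escaping_majorant:
  assumes \<rho>: "\<rho> \<in> c0star" and esc: "\<And>m C. m > 0 \<Longrightarrow> \<exists>n. C * hat \<xi> (n div m) < \<rho> n"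
  obtains \<eta> where "\<eta> \<in> c0star" "\<And>n. arith_mean \<xi> n \<le> arith_mean \<eta> n"
    "\<And>m C. m > 0 \<Longrightarrow> \<exists>n. C * \<eta> (n div m) < \<rho> n"
proof -
  \<comment> \<open>The state is the pair of a step's starting point and the index at which
    \<open>hat \<xi>\<close> supplies its height.\<close>
  let ?Q = "\<lambda>j x y. fst x < fst y \<and> hat \<xi> (snd y) \<le> hat \<xi> (snd x) / 2 \<and>
      real (Suc (snd y)) * \<xi> 0 \<le> real (fst y) * hat \<xi> (snd x) \<and>
      (\<exists>n. n div Suc j = fst y \<and> real (Suc j) * hat \<xi> (snd y) < \<rho> n)"
  have "\<exists>x :: nat \<times> nat. 0 = (0::nat) \<longrightarrow> x = (0, 0)"
    by blast
  moreover have "\<exists>y. (Suc j = 0 \<longrightarrow> y = (0, 0)) \<and> ?Q j x y" for x :: "nat \<times> nat" and j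
    using escape_step[OF assms, of "fst x" "snd x" j] by fastforce
  ultimately obtain z :: "nat \<Rightarrow> nat \<times> nat"
    where "\<forall>j. (j = 0 \<longrightarrow> z j = (0, 0)) \<and> ?Q j (z j) (z (Suc j))"
    using dependent_nat_choice[of "\<lambda>j x. j = 0 \<longrightarrow> x = (0, 0)" ?Q] by blast
  then have z0: "z 0 = (0, 0)" and z: "\<And>j. ?Q j (z j) (z (Suc j))"
    by blast+
  define p where "p j = fst (z j)" for j
  define a where "a j = hat \<xi> (snd (z j))" for j
  have p0: "p 0 = 0" and a0: "a 0 = \<xi> 0"
    by (simp_all add: p_def a_def z0 hat_0)
  have a_pos: "0 < a j" for j
    by (simp add: a_def hat_pos)
  have p_mono: "strict_mono p"
    using z by (simp add: strict_mono_Suc_iff p_def)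
  have a_half: "a (Suc j) \<le> a j / 2" for j
    using z by (simp add: a_def)
  have a_dec: "decseq a"
    by (rule decseq_SucI) (use a_half a_pos in \<open>smt (verit) field_sum_of_halves\<close>)
  \<comment> \<open>The halving demanded at each step makes the heights tend to 0.\<close>
  have "a j \<le> \<xi> 0 * (1 / 2) ^ j" for j
  proof (induction j)
    case (Suc j)
    with a_half[of j] show ?case
      by simp
  qed (simp add: a0)
  moreover have "(\<lambda>j. \<xi> 0 * (1 / 2) ^ j) \<longlonglongrightarrow> 0"
    by (intro tendsto_mult_right_zero LIMSEQ_power_zero) simp
  ultimately have a_lim: "a \<longlonglongrightarrow> 0"
    using less_imp_le[OF a_pos]
    by (intro tendsto_sandwich[OF _ _ tendsto_const, of 0 a sequentially "\<lambda>j. \<xi> 0 * (1 / 2) ^ j"])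
       (simp_all add: always_eventually)
  \<comment> \<open>\<open>J i\<close> is the number of the step containing \<open>i\<close>. The
    maximum is over a finite set because \<open>p\<close> is strictly increasing, and a nonempty one
    because \<open>p 0 = 0\<close>.\<close>
  define J where "J i = Max {j. p j \<le> i}" for i
  have fin: "finite {j. p j \<le> i}" for i
    by (rule finite_subset[of _ "{..i}"])
       (use strict_mono_imp_increasing[OF p_mono] order_trans in auto)
  have le_J: "j \<le> J i" if "p j \<le> i" for i j
    unfolding J_def using that fin by (intro Max_ge) auto
  have p_J: "p (J i) \<le> i" for i
  proof -
    have "0 \<in> {j. p j \<le> i}"
      using p0 by simp
    then have "Max {j. p j \<le> i} \<in> {j. p j \<le> i}"
      by (intro Max_in fin) blast
    then show ?thesis
      by (simp add: J_def)
  qed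
  have J_mono: "J i \<le> J i'" if "i \<le> i'" for i i'
    using le_J[OF order_trans[OF p_J that]] .
  define \<eta> where "\<eta> i = a (J i)" for i
  have \<eta>: "\<eta> \<in> c0star"
  proof -
    have "filterlim J at_top sequentially"
      unfolding filterlim_at_top eventually_sequentially using le_J by blast
    then have "\<eta> \<longlonglongrightarrow> 0"
      unfolding \<eta>_def by (rule filterlim_compose[OF a_lim])
    moreover have "decseq \<eta>"
      using a_dec J_mono by (auto simp: \<eta>_def decseq_def)
    ultimately show ?thesis
      using a_pos by (simp add: c0star_def \<eta>_def less_imp_le)
  qed
  have "arith_mean \<xi> n \<le> arith_mean \<eta> n" for n
  proof -
    define j where "j = J n"
    have E: "real (Suc n) * a j \<le> (\<Sum>i<Suc n. \<eta> i)"
    proof -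
      have "a j \<le> \<eta> i" if "i < Suc n" for i
        using that a_dec J_mono[of i n] by (simp add: \<eta>_def j_def decseq_def)
      then show ?thesis
        using sum_bounded_below[of "{..<Suc n}" "a j" \<eta>] by simp
    qed
    have "(\<Sum>i<Suc n. \<xi> i) \<le> (\<Sum>i<Suc n. \<eta> i)"
    \<comment> \<open>Past \<open>nu\<close> the mean of \<xi> is below the current height, and no
      earlier value of \<eta> is smaller. Before \<open>nu\<close>, the first step has height
      \<open>\<xi> 0\<close>, a bound for all terms of \<xi>; on a later step the indices below
      \<open>p j\<close> alone already contribute at least
      \<open>Suc (snd (z j)) * \<xi> 0\<close>.\<close>
    proof (cases "nu \<xi> (Suc (snd (z j))) \<le> Suc n")
      case True
      then show ?thesis
        using sum_le_mult_hat[OF True] E by (simp add: a_def)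
    next
      case False
      show ?thesis
      proof (cases j)
        case 0
        then show ?thesis
          using sum_le_mult_first[of "Suc n"] E a0 by simp
      next
        case (Suc j')
        have "a j' \<le> \<eta> i" if "i < p j" for i
        proof -
          have "p (J i) < p j"
            using p_J[of i] that by simp
          then have "J i \<le> j'"
            using p_mono Suc by (simp add: strict_mono_less)
          then show ?thesis
            using a_dec by (simp add: \<eta>_def decseq_def)
        qed
        then have "real (p j) * a j' \<le> (\<Sum>i<p j. \<eta> i)"
          using sum_bounded_below[of "{..<p j}" "a j'" \<eta>] by simp
        also have "\<dots> \<le> (\<Sum>i<Suc n. \<eta> i)"
          using p_J[of n] c0star_nonneg[OF \<eta>] by (intro sum_mono2) (auto simp: j_def)
        finally have "real (p j) * a j' \<le> (\<Sum>i<Suc n. \<eta> i)" .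
        moreover have "real (Suc (snd (z j))) * \<xi> 0 \<le> real (p j) * a j'"
          unfolding Suc a_def p_def using z by blast
        moreover have "(\<Sum>i<Suc n. \<xi> i) \<le> real (Suc (snd (z j))) * \<xi> 0"
          using False by (intro sum_less_nu_le) simp
        ultimately show ?thesis
          by linarith
      qed
    qed
    then show ?thesis
      unfolding arith_mean_def lessThan_Suc_atMost by (rule divide_right_mono) simp
  qed
  moreover have "\<exists>n. C * \<eta> (n div m) < \<rho> n" if m: "m > 0" for m C
  proof -
    obtain j0 where j0: "\<bar>C\<bar> < real j0"
      using reals_Archimedean2 by blast
    \<comment> \<open>\<open>Suc j\<close> exceeds both \<open>m\<close> and the absolute value of
      \<open>C\<close>, so the index picked against dilation and constant \<open>Suc j\<close> also
      defeats the given pair.\<close>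
    define j where "j = m + j0"
    obtain n where n: "n div Suc j = p (Suc j)" "real (Suc j) * a (Suc j) < \<rho> n"
      using z[of j] by (auto simp: p_def a_def)
    have "p (Suc j) \<le> n div m"
      unfolding n(1)[symmetric] using m by (intro div_le_mono2) (auto simp: j_def)
    then have "\<eta> (n div m) \<le> a (Suc j)"
      using a_dec le_J[of "Suc j" "n div m"] by (simp add: \<eta>_def decseq_def)
    then have "C * \<eta> (n div m) \<le> real (Suc j) * a (Suc j)"
      using j0 c0star_nonneg[OF \<eta>, of "n div m"]
      by (intro mult_mono) (auto simp: j_def)
    with n(2) show ?thesis
      by (intro exI[of _ n]) simp
  qed
  ultimately show ?thesis
    using that \<eta> by blast
qed

end

theorem theorem6p14:
  fixes e :: "nat \<Rightarrow> 'h::complex_hilbert"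
    and \<xi> :: "nat \<Rightarrow> real"
  assumes "orthonormal_basis e"
    and "\<xi> \<in> c0star"
    and "\<not> summable \<xi>"
  shows "(\<forall>\<eta>\<in>c0star. (\<forall>n. arith_mean \<eta> n \<ge> arith_mean \<xi> n) \<longrightarrow>
            (\<forall>\<epsilon>>0. \<forall>\<^sub>F n in sequentially. \<eta> n \<ge> (1 - \<epsilon>) * hat \<xi> n)) \<and>
         (\<forall>\<rho>\<in>c0star - char_set (principal_ideal e (hat \<xi>)).
            \<exists>\<eta>\<in>c0star. (\<forall>n. arith_mean \<eta> n \<ge> arith_mean \<xi> n) \<and>
              \<rho> \<notin> char_set (principal_ideal e \<eta>))"
proof (intro conjI ballI impI allI)
  fix \<eta> and \<epsilon> :: real
  assume "\<eta> \<in> c0star" "\<forall>n. arith_mean \<eta> n \<ge> arith_mean \<xi> n" "\<epsilon> > 0"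
  then show "\<forall>\<^sub>F n in sequentially. \<eta> n \<ge> (1 - \<epsilon>) * hat \<xi> n"
    using hat_minimal[OF assms(2,3)] by blast
next
  fix \<rho> assume "\<rho> \<in> c0star - char_set (principal_ideal e (hat \<xi>))"
  then have \<rho>: "\<rho> \<in> c0star" and "\<rho> \<notin> char_set (principal_ideal e (hat \<xi>))"
    by auto
  then have esc: "\<exists>n. C * hat \<xi> (n div m) < \<rho> n" if "m > 0" for m C
    using that unfolding mem_char_set_principal_ideal_iff[OF assms(1) hat_c0star[OF assms(2,3)] \<rho>]
    by (metis not_le)
  obtain \<eta> where \<eta>: "\<eta> \<in> c0star" "\<And>n. arith_mean \<xi> n \<le> arith_mean \<eta> n"
    "\<And>m C. m > 0 \<Longrightarrow> \<exists>n. C * \<eta> (n div m) < \<rho> n"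
    using escaping_majorant[OF assms(2,3) \<rho> esc] by blast
  have "\<rho> \<notin> char_set (principal_ideal e \<eta>)"
    unfolding mem_char_set_principal_ideal_iff[OF assms(1) \<eta>(1) \<rho>] using \<eta>(3) by (metis not_le)
  with \<eta>(1,2) show "\<exists>\<eta>\<in>c0star. (\<forall>n. arith_mean \<eta> n \<ge> arith_mean \<xi> n) \<and>
      \<rho> \<notin> char_set (principal_ideal e \<eta>)"
    by blast
qed

end
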